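(* Let $\varepsilon:\mathfrak X_1\to\mathfrak X_2$ be a functor, and let $F_1:\mathfrak X_1\to\mathfrak S_p$ and $F_2:\mathfrak X_2\to\mathfrak S_p$ be functors such that $F_1$ and $F_2\varepsilon$ are either both covariant or both contravariant. Let $0<C\in\mathbb R$. Then: (a) if $(\mathbf h_{F_1},\mathbf h_{F_2})$ satisfies $SBT_{\varepsilon,C}$, then $(\mathbf h_{F_1},\mathbf h_{F_2})$ satisfies $SBT^w_{\varepsilon,C}$; (b) if $(\mathbf h_{F_1},\mathbf h_{F_2})$ satisfies $SBT^w_{\varepsilon,C}$, then $(\mathbf h_{F_1},\mathbf h_{F_2})$ satisfies $BT_{\varepsilon,C}$. In particular (case $C=1$), if $(\mathbf h_{F_1},\mathbf h_{F_2})$ satisfies $SBT_\varepsilon$ then it satisfies $SBT^w_\varepsilon$, and if it satisfies $SBT^w_\varepsilon$ then it satisfies $BT_\varepsilon$.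
   Context: A normed semigroup $(S,v)$ is a semigroup $S$ with an arbitrary function (norm) $v:S\to\mathbb R_{\ge0}$. $\mathfrak S^*$ is the category of normed semigroups and all semigroup homomorphisms; $\mathfrak S$ is its subcategory with the same objects and only the contractive homomorphisms $\phi:(S,v)\to(S',v')$, i.e. $v'(\phi(x))\le v(x)$ for all $x\in S$. A preordered semigroup is a semigroup with a preorder $\le$ such that $x\le y$ implies $xz\le yz$ and $zx\le zy$. $\mathfrak S_p$ is the category of normed preordered semigroups (preordered semigroups with a monotone norm) and contractive monotone semigroup homomorphisms. A subset $T$ of $S$ is cofinal if every $s\in S$ satisfies $s\le t$ for some $t\in T$. For an endomorphism $\phi:S\to S$ of a normed semigroup, $T_n(\phi,x)=x\cdot\phi(x)\cdots\phi^{n-1}(x)$, $h_{\mathfrak S}(\phi,x)=\limsup_{n\to\infty}\frac{v(T_n(\phi,x))}{n}$ and $h_{\mathfrak S}(\phi)=\sup_{x\in S}h_{\mathfrak S}(\phi,x)\in[0,\infty]$. For a (covariant or contravariant) functor $F:\mathfrak X\to\mathfrak S$ (or with values in a subcategory of $\mathfrak S$) the functorial entropy of an endomorphism $\phi$ in $\mathfrak X$ is $\mathbf h_F(\phi)=h_{\mathfrak S}(F(\phi))$. A homomorphism $\alpha:(S,v)\to(S',v')$ in $\mathfrak S^*$ is a uniform isomorphism with coefficient $r>0$ ($r\in\mathbb R$) if it is a semigroup isomorphism and $v'(\alpha(x))=r\,v(x)$ for all $x\in S$. A homomorphism $\alpha:S\to T$ in $\mathfrak S^*$ into a normed preordered semigroup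 $T$ is a weak isomorphism with coefficient $r>0$ if $\alpha:S\to\alpha(S)$ is a uniform isomorphism with coefficient $r$ (with the restricted norm on $\alpha(S)$) and $\alpha(S)$ is cofinal in $T$. $SBT_{\varepsilon,C}$ for $(\mathbf h_{F_1},\mathbf h_{F_2})$ means: there is a natural transformation $\eta:F_1\to F_2\varepsilon$ (with components in $\mathfrak S^*$) such that every $\eta_X:F_1(X)\to F_2\varepsilon(X)$ is a uniform isomorphism with coefficient $C$. $SBT^w_{\varepsilon,C}$ means the same with "weak isomorphism with coefficient $C$" instead. $BT_{\varepsilon,C}$ means: $\mathbf h_{F_2}(\varepsilon(\phi))=C\,\mathbf h_{F_1}(\phi)$ for every endomorphism $\phi:X\to X$ in $\mathfrak X_1$. When $C=1$ the index $C$ is omitted. *)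

theory Defs
  imports "HOL-Analysis.Analysis" "HOL-Algebra.Congruence"
begin

record ('o, 'm) cat =
  Obj :: "'o set"
  Arr :: "'m set"
  Dom :: "'m \<Rightarrow> 'o"
  Cod :: "'m \<Rightarrow> 'o"
  Ident :: "'o \<Rightarrow> 'm"
  Comp :: "'m \<Rightarrow> 'm \<Rightarrow> 'm"  \<comment> \<open>\<open>Comp C g f\<close> is \<open>g\<close> after \<open>f\<close>\<close>

definition hom_set :: "('o, 'm) cat \<Rightarrow> 'o \<Rightarrow> 'o \<Rightarrow> 'm set" where
  "hom_set C X Y = {f \<in> Arr C. Dom C f = X \<and> Cod C f = Y}"

locale category =
  fixes C :: "('o, 'm) cat"
  assumes Dom_in_Obj: "f \<in> Arr C \<Longrightarrow> Dom C f \<in> Obj C"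
    and Cod_in_Obj: "f \<in> Arr C \<Longrightarrow> Cod C f \<in> Obj C"
    and Ident_in_hom: "X \<in> Obj C \<Longrightarrow> Ident C X \<in> hom_set C X X"
    and Comp_in_hom: "f \<in> Arr C \<Longrightarrow> g \<in> Arr C \<Longrightarrow> Dom C g = Cod C f
      \<Longrightarrow> Comp C g f \<in> hom_set C (Dom C f) (Cod C g)"
    and Comp_Ident_right: "f \<in> Arr C \<Longrightarrow> Comp C f (Ident C (Dom C f)) = f"
    and Comp_Ident_left: "f \<in> Arr C \<Longrightarrow> Comp C (Ident C (Cod C f)) f = f"
    and Comp_assoc: "f \<in> Arr C \<Longrightarrow> g \<in> Arr C \<Longrightarrow> h \<in> Arr C
      \<Longrightarrow> Dom C g = Cod C f \<Longrightarrow> Dom C h = Cod C g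
      \<Longrightarrow> Comp C h (Comp C g f) = Comp C (Comp C h g) f"

definition opposite :: "('o, 'm) cat \<Rightarrow> ('o, 'm) cat" where
  "opposite C = \<lparr>Obj = Obj C, Arr = Arr C, Dom = Cod C, Cod = Dom C,
     Ident = Ident C, Comp = (\<lambda>g f. Comp C f g)\<rparr>"

datatype variance = Covariant | Contravariant

record ('o, 'm, 'p, 'n) func =
  var :: variance
  omap :: "'o \<Rightarrow> 'p"
  amap :: "'m \<Rightarrow> 'n"

text \<open>A contravariant functor on \<open>C\<close> is treated as a covariant functor on the opposite of \<open>C\<close>.\<close>

definition source_cat :: "('o, 'm) cat \<Rightarrow> ('o, 'm, 'p, 'n) func \<Rightarrow> ('o, 'm) cat" where
  "source_cat C F = (case var F of Covariant \<Rightarrow> C | Contravariant \<Rightarrow> opposite C)"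

definition is_functor ::
    "('o, 'm) cat \<Rightarrow> ('p, 'n) cat \<Rightarrow> ('o, 'm, 'p, 'n) func \<Rightarrow> bool" where
  "is_functor C D F \<longleftrightarrow>
     (let C' = source_cat C F in
       (\<forall>X \<in> Obj C'. omap F X \<in> Obj D) \<and>
       (\<forall>f \<in> Arr C'. amap F f \<in> hom_set D (omap F (Dom C' f)) (omap F (Cod C' f))) \<and>
       (\<forall>X \<in> Obj C'. amap F (Ident C' X) = Ident D (omap F X)) \<and>
       (\<forall>f \<in> Arr C'. \<forall>g \<in> Arr C'. Dom C' g = Cod C' f \<longrightarrow>
          amap F (Comp C' g f) = Comp D (amap F g) (amap F f)))"

definition comp_func ::
    "('p, 'n, 'q, 'l) func \<Rightarrow> ('o, 'm, 'p, 'n) func \<Rightarrow> ('o, 'm, 'q, 'l) func"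
    (infixl "\<circ>\<^sub>F" 55) where
  "G \<circ>\<^sub>F F = \<lparr>var = (if var G = var F then Covariant else Contravariant),
     omap = omap G \<circ> omap F, amap = amap G \<circ> amap F\<rparr>"

definition natural_transformation ::
    "('o, 'm) cat \<Rightarrow> ('p, 'n) cat \<Rightarrow> ('o, 'm, 'p, 'n) func \<Rightarrow> ('o, 'm, 'p, 'n) func
      \<Rightarrow> ('o \<Rightarrow> 'n) \<Rightarrow> bool" where
  "natural_transformation C D F G \<eta> \<longleftrightarrow>
     is_functor C D F \<and> is_functor C D G \<and> var F = var G \<and>
     (\<forall>X \<in> Obj C. \<eta> X \<in> hom_set D (omap F X) (omap G X)) \<and>
     (let C' = source_cat C F in
       \<forall>f \<in> Arr C'. Comp D (\<eta> (Cod C' f)) (amap F f) = Comp D (amap G f) (\<eta> (Dom C' f)))"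

record 's normed_semigroup = "'s partial_object" +
  mul :: "'s \<Rightarrow> 's \<Rightarrow> 's"
  nrm :: "'s \<Rightarrow> real"

record 's normed_preordered_semigroup = "'s normed_semigroup" +
  leq :: "('s \<times> 's) set"

definition normed_semigroup :: "('s, 'z) normed_semigroup_scheme \<Rightarrow> bool" where
  "normed_semigroup S \<longleftrightarrow>
     (\<forall>x \<in> carrier S. \<forall>y \<in> carrier S. mul S x y \<in> carrier S) \<and>
     (\<forall>x \<in> carrier S. \<forall>y \<in> carrier S. \<forall>z \<in> carrier S.
        mul S (mul S x y) z = mul S x (mul S y z)) \<and>
     (\<forall>x \<in> carrier S. 0 \<le> nrm S x)"

definition normed_preordered_semigroup :: "'s normed_preordered_semigroup \<Rightarrow> bool" where
  "normed_preordered_semigroup S \<longleftrightarrow>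
     normed_semigroup S \<and>
     preorder_on (carrier S) (leq S) \<and>
     (\<forall>x \<in> carrier S. \<forall>y \<in> carrier S. \<forall>z \<in> carrier S. (x, y) \<in> leq S \<longrightarrow>
        (mul S x z, mul S y z) \<in> leq S \<and> (mul S z x, mul S z y) \<in> leq S) \<and>
     (\<forall>x \<in> carrier S. \<forall>y \<in> carrier S. (x, y) \<in> leq S \<longrightarrow> nrm S x \<le> nrm S y)"

definition semigroup_hom ::
    "('s, 'z) normed_semigroup_scheme \<Rightarrow> ('t, 'w) normed_semigroup_scheme \<Rightarrow> ('s \<Rightarrow> 't) \<Rightarrow> bool"
  where
  "semigroup_hom S T f \<longleftrightarrow> f \<in> carrier S \<rightarrow> carrier T \<and>
     (\<forall>x \<in> carrier S. \<forall>y \<in> carrier S. f (mul S x y) = mul T (f x) (f y))"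

definition contractive ::
    "('s, 'z) normed_semigroup_scheme \<Rightarrow> ('t, 'w) normed_semigroup_scheme \<Rightarrow> ('s \<Rightarrow> 't) \<Rightarrow> bool"
  where
  "contractive S T f \<longleftrightarrow> (\<forall>x \<in> carrier S. nrm T (f x) \<le> nrm S x)"

definition monotone_map ::
    "'s normed_preordered_semigroup \<Rightarrow> 't normed_preordered_semigroup \<Rightarrow> ('s \<Rightarrow> 't) \<Rightarrow> bool"
  where
  "monotone_map S T f \<longleftrightarrow>
     (\<forall>x \<in> carrier S. \<forall>y \<in> carrier S. (x, y) \<in> leq S \<longrightarrow> (f x, f y) \<in> leq T)"

definition cofinal_subset :: "'s normed_preordered_semigroup \<Rightarrow> 's set \<Rightarrow> bool" where
  "cofinal_subset S T \<longleftrightarrow> T \<subseteq> carrier S \<and> (\<forall>s \<in> carrier S. \<exists>t \<in> T. (s, t) \<in> leq S)"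

text \<open>
  The semigroups considered have their carriers inside one type \<open>'s\<close>, which is arbitrary and
  plays the role of the universe. An arrow records its source and target; its underlying map is
  extensional, so that equal arrows are those agreeing on the carrier of the source.
\<close>

datatype ('b, 's) arrow = Arrow (source: 'b) (fn: "'s \<Rightarrow> 's") (target: 'b)

definition concrete_cat ::
    "('b \<Rightarrow> 's set) \<Rightarrow> 'b set \<Rightarrow> ('b \<Rightarrow> 'b \<Rightarrow> ('s \<Rightarrow> 's) \<Rightarrow> bool) \<Rightarrow> ('b, ('b, 's) arrow) cat" where
  "concrete_cat U B H =
     \<lparr>Obj = B,
      Arr = {Arrow S f T | S f T. S \<in> B \<and> T \<in> B \<and> f \<in> extensional (U S) \<and> H S T f},
      Dom = source,
      Cod = target,
      Ident = (\<lambda>S. Arrow S (restrict (\<lambda>x. x) (U S)) S),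
      Comp = (\<lambda>g f. Arrow (source f) (compose (U (source f)) (fn g) (fn f)) (target g))\<rparr>"

definition NSemi_star :: "('s normed_semigroup, ('s normed_semigroup, 's) arrow) cat" where
  "NSemi_star = concrete_cat carrier {S. normed_semigroup S} semigroup_hom"

definition NSemi_p ::
    "('s normed_preordered_semigroup, ('s normed_preordered_semigroup, 's) arrow) cat" where
  "NSemi_p = concrete_cat carrier {S. normed_preordered_semigroup S}
     (\<lambda>S T f. semigroup_hom S T f \<and> contractive S T f \<and> monotone_map S T f)"

definition forget_preorder :: "'s normed_preordered_semigroup \<Rightarrow> 's normed_semigroup" where
  "forget_preorder S = \<lparr>carrier = carrier S, mul = mul S, nrm = nrm S\<rparr>"

definition Forget ::
    "('s normed_preordered_semigroup, ('s normed_preordered_semigroup, 's) arrow,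
      's normed_semigroup, ('s normed_semigroup, 's) arrow) func" where
  "Forget = \<lparr>var = Covariant, omap = forget_preorder,
     amap = (\<lambda>a. Arrow (forget_preorder (source a)) (fn a) (forget_preorder (target a)))\<rparr>"

lemma category_concrete_cat:
  assumes hom_funcset: "\<And>S T f. S \<in> B \<Longrightarrow> T \<in> B \<Longrightarrow> H S T f \<Longrightarrow> f \<in> U S \<rightarrow> U T"
    and hom_id: "\<And>S. S \<in> B \<Longrightarrow> H S S (restrict (\<lambda>x. x) (U S))"
    and hom_comp: "\<And>R S T f g. R \<in> B \<Longrightarrow> S \<in> B \<Longrightarrow> T \<in> B \<Longrightarrow> H R S f \<Longrightarrow> H S T g
      \<Longrightarrow> H R T (compose (U R) g f)"
  shows "category (concrete_cat U B H)" (is "category ?C")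
proof -
  have arr: "f \<in> Arr ?C \<longleftrightarrow> source f \<in> B \<and> target f \<in> B \<and>
      fn f \<in> extensional (U (source f)) \<and> H (source f) (target f) (fn f)" for f
    by (cases f) (simp add: concrete_cat_def)
  have sel: "Obj ?C = B" "Dom ?C = source" "Cod ?C = target"
    "Ident ?C S = Arrow S (restrict (\<lambda>x. x) (U S)) S"
    "Comp ?C g f = Arrow (source f) (compose (U (source f)) (fn g) (fn f)) (target g)"
    for S f g
    by (simp_all add: concrete_cat_def)
  have fn: "fn f \<in> U (source f) \<rightarrow> U (target f)" if "f \<in> Arr ?C" for f
    using that hom_funcset unfolding arr by blast
  show ?thesis
  proof (standard, goal_cases)
    case (4 f g)
    then show ?case
      using hom_comp[of "source f" "target f" "target g" "fn f" "fn g"]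
      by (simp add: arr sel hom_set_def)
  next
    case (5 f)
    then show ?case
      using compose_Id[OF fn] by (simp add: arr sel arrow.expand)
  next
    case (6 f)
    then show ?case
      using Id_compose[OF fn] by (simp add: arr sel arrow.expand)
  next
    case (7 f g h)
    then show ?case
      using compose_assoc[OF fn, of f "fn h" "fn g"] by (simp add: sel)
  qed (simp_all add: arr sel hom_set_def hom_id)
qed

lemma category_NSemi_star: "category NSemi_star"
  unfolding NSemi_star_def
  by (rule category_concrete_cat)
    (auto simp: semigroup_hom_def normed_semigroup_def compose_def Pi_iff)

lemma category_NSemi_p: "category NSemi_p"
  unfolding NSemi_p_def
proof (rule category_concrete_cat, goal_cases)
  case (1 S T f)
  then show ?case by (simp add: semigroup_hom_def)
next
  case (2 S)
  then show ?case
    by (simp add: semigroup_hom_def contractive_def monotone_map_def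
        normed_preordered_semigroup_def normed_semigroup_def)
next
  case (3 R S T f g)
  then have f: "f x \<in> carrier S" if "x \<in> carrier R" for x
    using that by (simp add: semigroup_hom_def Pi_iff)
  have "semigroup_hom R T (compose (carrier R) g f)"
    using 3 f by (simp add: semigroup_hom_def normed_semigroup_def
        normed_preordered_semigroup_def compose_def Pi_iff)
  moreover have "contractive R T (compose (carrier R) g f)"
    unfolding contractive_def
  proof
    fix x assume x: "x \<in> carrier R"
    have "nrm T (g (f x)) \<le> nrm S (f x)" "nrm S (f x) \<le> nrm R x"
      using 3 f x by (simp_all add: contractive_def)
    then show "nrm T (compose (carrier R) g f x) \<le> nrm R x"
      using x by (simp add: compose_def)
  qed
  moreover have "monotone_map R T (compose (carrier R) g f)"
    using 3 f by (simp add: monotone_map_def compose_def)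
  ultimately show ?case by blast
qed

lemma is_functor_Forget: "is_functor NSemi_p NSemi_star Forget"
  by (auto simp: is_functor_def source_cat_def Forget_def NSemi_p_def NSemi_star_def
      concrete_cat_def hom_set_def forget_preorder_def normed_preordered_semigroup_def
      normed_semigroup_def semigroup_hom_def)

text \<open>
  \<open>trajectory S \<phi> x n\<close> is \<open>T\<^sub>n(\<phi>, x) = x \<cdot> \<phi>(x) \<cdots> \<phi>\<^sup>n\<^sup>-\<^sup>1(x)\<close> for \<open>n \<ge> 1\<close>. A semigroup has no
  empty product, so the value at \<open>0\<close> is arbitrary; the limit superior below does not see it.
\<close>

fun trajectory :: "('s, 'z) normed_semigroup_scheme \<Rightarrow> ('s \<Rightarrow> 's) \<Rightarrow> 's \<Rightarrow> nat \<Rightarrow> 's" where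
  "trajectory S \<phi> x 0 = x"
| "trajectory S \<phi> x (Suc 0) = x"
| "trajectory S \<phi> x (Suc (Suc n)) = mul S (trajectory S \<phi> x (Suc n)) ((\<phi> ^^ Suc n) x)"

definition semigroup_entropy_at ::
    "('s, 'z) normed_semigroup_scheme \<Rightarrow> ('s \<Rightarrow> 's) \<Rightarrow> 's \<Rightarrow> ennreal" where
  "semigroup_entropy_at S \<phi> x =
     limsup (\<lambda>n. ennreal (nrm S (trajectory S \<phi> x n) / real n))"

definition semigroup_entropy ::
    "('s, 'z) normed_semigroup_scheme \<Rightarrow> ('s \<Rightarrow> 's) \<Rightarrow> ennreal" where
  "semigroup_entropy S \<phi> = (SUP x \<in> carrier S. semigroup_entropy_at S \<phi> x)"

text \<open>
  Meant for endomorphisms \<open>\<phi>\<close>, so that source and target of \<open>amap F \<phi>\<close> coincide for either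
  variance of \<open>F\<close>.
\<close>

definition functorial_entropy ::
    "('o, 'm, ('s, 'z) normed_semigroup_scheme, (('s, 'z) normed_semigroup_scheme, 's) arrow) func
      \<Rightarrow> 'm \<Rightarrow> ennreal" where
  "functorial_entropy F \<phi> = semigroup_entropy (source (amap F \<phi>)) (fn (amap F \<phi>))"

definition uniform_isomorphism ::
    "real \<Rightarrow> 's normed_semigroup \<Rightarrow> 't normed_semigroup \<Rightarrow> ('s \<Rightarrow> 't) \<Rightarrow> bool" where
  "uniform_isomorphism r S T \<alpha> \<longleftrightarrow>
     0 < r \<and> semigroup_hom S T \<alpha> \<and> bij_betw \<alpha> (carrier S) (carrier T) \<and>
     (\<forall>x \<in> carrier S. nrm T (\<alpha> x) = r * nrm S x)"

definition weak_isomorphism ::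
    "real \<Rightarrow> 's normed_semigroup \<Rightarrow> 't normed_preordered_semigroup \<Rightarrow> ('s \<Rightarrow> 't) \<Rightarrow> bool" where
  "weak_isomorphism r S T \<alpha> \<longleftrightarrow>
     semigroup_hom S (forget_preorder T) \<alpha> \<and>
     uniform_isomorphism r S (forget_preorder T \<lparr>carrier := \<alpha> ` carrier S\<rparr>) \<alpha> \<and>
     cofinal_subset T (\<alpha> ` carrier S)"

type_synonym ('o, 'm, 's) nps_functor =
  "('o, 'm, 's normed_preordered_semigroup, ('s normed_preordered_semigroup, 's) arrow) func"

definition SBT ::
    "('o1, 'm1) cat \<Rightarrow> ('o1, 'm1, 'o2, 'm2) func \<Rightarrow> real
      \<Rightarrow> ('o1, 'm1, 's) nps_functor \<Rightarrow> ('o2, 'm2, 's) nps_functor \<Rightarrow> bool" where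
  "SBT X1 \<epsilon> C F1 F2 \<longleftrightarrow>
     (\<exists>\<eta>. natural_transformation X1 NSemi_star (Forget \<circ>\<^sub>F F1) (Forget \<circ>\<^sub>F (F2 \<circ>\<^sub>F \<epsilon>)) \<eta> \<and>
       (\<forall>X \<in> Obj X1. uniform_isomorphism C (forget_preorder (omap F1 X))
          (forget_preorder (omap (F2 \<circ>\<^sub>F \<epsilon>) X)) (fn (\<eta> X))))"

definition SBT_weak ::
    "('o1, 'm1) cat \<Rightarrow> ('o1, 'm1, 'o2, 'm2) func \<Rightarrow> real
      \<Rightarrow> ('o1, 'm1, 's) nps_functor \<Rightarrow> ('o2, 'm2, 's) nps_functor \<Rightarrow> bool" where
  "SBT_weak X1 \<epsilon> C F1 F2 \<longleftrightarrow>
     (\<exists>\<eta>. natural_transformation X1 NSemi_star (Forget \<circ>\<^sub>F F1) (Forget \<circ>\<^sub>F (F2 \<circ>\<^sub>F \<epsilon>)) \<eta> \<and>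
       (\<forall>X \<in> Obj X1. weak_isomorphism C (forget_preorder (omap F1 X))
          (omap (F2 \<circ>\<^sub>F \<epsilon>) X) (fn (\<eta> X))))"

definition BT ::
    "('o1, 'm1) cat \<Rightarrow> ('o1, 'm1, 'o2, 'm2) func \<Rightarrow> real
      \<Rightarrow> ('o1, 'm1, 's) nps_functor \<Rightarrow> ('o2, 'm2, 's) nps_functor \<Rightarrow> bool" where
  "BT X1 \<epsilon> C F1 F2 \<longleftrightarrow>
     (\<forall>X \<in> Obj X1. \<forall>\<phi> \<in> hom_set X1 X X.
        functorial_entropy F2 (amap \<epsilon> \<phi>) = ennreal C * functorial_entropy F1 \<phi>)"

end

theory Submission
  imports Defs
begin

text \<open>
  A weak isomorphism \<open>\<alpha>\<close> that intertwines two endomorphisms maps trajectories to trajectories and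
  scales their norms by \<open>C\<close>, so it scales the entropy at each point by \<open>C\<close>. Monotonicity makes the
  entropy at a point monotone in that point, so the supremum over the target may be taken over the
  cofinal image of \<open>\<alpha>\<close> only.
\<close>

text \<open>Multiplication by a finite constant is monotone and continuous on
  \<open>ennreal\<close>, hence commutes with \<open>limsup\<close>. For \<open>c = top\<close>
  continuity would fail at 0.\<close>

lemma limsup_cmult_ennreal:
  fixes c :: ennreal
  assumes "c < top"
  shows "limsup (\<lambda>n. c * u n) = c * limsup u"
  using assms
  by (intro Limsup_compose_continuous_mono ennreal_continuous_on_cmult continuous_on_id)
    (simp_all add: mono_def mult_left_mono)

lemma funpow_closed:
  assumes "f \<in> A \<rightarrow> A" and "x \<in> A"
  shows "(f ^^ n) x \<in> A"
  using assms by (induction n) auto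

lemma funpow_intertwine:
  assumes "f \<in> A \<rightarrow> A" and "\<And>x. x \<in> A \<Longrightarrow> \<alpha> (f x) = g (\<alpha> x)" and "x \<in> A"
  shows "\<alpha> ((f ^^ n) x) = (g ^^ n) (\<alpha> x)"
  using assms by (induction n) (auto simp: funpow_closed)

lemma trajectory_closed:
  assumes "\<And>x y. x \<in> carrier S \<Longrightarrow> y \<in> carrier S \<Longrightarrow> mul S x y \<in> carrier S"
    and "f \<in> carrier S \<rightarrow> carrier S" and "x \<in> carrier S"
  shows "trajectory S f x n \<in> carrier S"
  using assms
\<comment> \<open>This rule splits as the equations of \<open>trajectory\<close> do: the arbitrary
  value at 0, the start at 1, and the recursion.\<close>
proof (induction n rule: induct_nat_012)
  case (ge2 n)
  then show ?case
    using funpow_closed[of f "carrier S" x "Suc n"] by simp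
qed simp_all

lemma trajectory_hom:
  assumes "\<And>x y. x \<in> carrier S \<Longrightarrow> y \<in> carrier S \<Longrightarrow> mul S x y \<in> carrier S"
    and "f \<in> carrier S \<rightarrow> carrier S"
    and "semigroup_hom S T \<alpha>"
    and "\<And>x. x \<in> carrier S \<Longrightarrow> \<alpha> (f x) = g (\<alpha> x)"
    and "x \<in> carrier S"
  shows "\<alpha> (trajectory S f x n) = trajectory T g (\<alpha> x) n"
proof (induction n rule: induct_nat_012)
  case (ge2 n)
  have "trajectory S f x (Suc n) \<in> carrier S" "(f ^^ Suc n) x \<in> carrier S"
    using assms trajectory_closed[of S f x "Suc n"] funpow_closed[of f "carrier S" x "Suc n"]
    by blast+
  then have "\<alpha> (trajectory S f x (Suc (Suc n)))
      = mul T (\<alpha> (trajectory S f x (Suc n))) (\<alpha> ((f ^^ Suc n) x))"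
    using assms(3) by (simp add: semigroup_hom_def del: funpow.simps)
  also have "\<alpha> ((f ^^ Suc n) x) = (g ^^ Suc n) (\<alpha> x)"
    using assms by (intro funpow_intertwine)
  finally show ?case
    using ge2 by simp
qed simp_all

text \<open>Only \<open>mul\<close> enters a trajectory. This links
  \<open>forget_preorder T\<close>, the target of the homomorphism \<open>\<alpha>\<close>, with
  \<open>T\<close> itself.\<close>

lemma trajectory_forget_preorder: "trajectory (forget_preorder S) f x n = trajectory S f x n"
  by (induction n rule: induct_nat_012) (simp_all add: forget_preorder_def)

lemma trajectory_mono:
  assumes S: "normed_preordered_semigroup S"
    and f: "f \<in> carrier S \<rightarrow> carrier S" and mono: "monotone_map S S f"
    and xy: "x \<in> carrier S" "y \<in> carrier S" "(x, y) \<in> leq S"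
  shows "(trajectory S f x n, trajectory S f y n) \<in> leq S"
proof (induction n rule: induct_nat_012)
  case (ge2 n)
  let ?a = "trajectory S f x (Suc n)" and ?b = "trajectory S f y (Suc n)"
  let ?c = "(f ^^ Suc n) x" and ?d = "(f ^^ Suc n) y"
  have mul: "mul S u v \<in> carrier S" if "u \<in> carrier S" "v \<in> carrier S" for u v
    using S that by (simp add: normed_preordered_semigroup_def normed_semigroup_def)
  have car: "?a \<in> carrier S" "?b \<in> carrier S" "?c \<in> carrier S" "?d \<in> carrier S"
    using mul f xy trajectory_closed[of S f _ "Suc n"] funpow_closed[of f "carrier S" _ "Suc n"]
    by blast+
  have "((f ^^ m) x, (f ^^ m) y) \<in> leq S" for m
    using xy f mono by (induction m) (auto simp: monotone_map_def funpow_closed)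
  \<comment> \<open>Compatibility of the preorder only compares products sharing a factor, so one
    factor changes at a time, through \<open>mul S ?b ?c\<close>.\<close>
  then have "(mul S ?a ?c, mul S ?b ?c) \<in> leq S" "(mul S ?b ?c, mul S ?b ?d) \<in> leq S"
    using S ge2 car by (auto simp: normed_preordered_semigroup_def simp del: funpow.simps)
  moreover have "trans (leq S)"
    using S by (simp add: normed_preordered_semigroup_def preorder_on_def)
  ultimately show ?case
    by (auto dest: transD)
qed (use xy in simp_all)

text \<open>The norm is monotone, so comparable trajectories have norms that compare term by term,
  and \<open>limsup\<close> preserves this.\<close>

lemma semigroup_entropy_at_mono:
  assumes S: "normed_preordered_semigroup S"
    and f: "f \<in> carrier S \<rightarrow> carrier S" and "monotone_map S S f"
    and xy: "x \<in> carrier S" "y \<in> carrier S" "(x, y) \<in> leq S"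
  shows "semigroup_entropy_at S f x \<le> semigroup_entropy_at S f y"
proof -
  have mul: "mul S u v \<in> carrier S" if "u \<in> carrier S" "v \<in> carrier S" for u v
    using S that by (simp add: normed_preordered_semigroup_def normed_semigroup_def)
  have "nrm S (trajectory S f x n) \<le> nrm S (trajectory S f y n)" for n
    using S trajectory_mono[OF assms, of n] trajectory_closed[of S f _ n] mul f xy
    unfolding normed_preordered_semigroup_def by blast
  then show ?thesis
    unfolding semigroup_entropy_at_def
    by (intro Limsup_mono always_eventually allI ennreal_leI divide_right_mono) simp_all
qed

text \<open>The content of \<open>BT\<close> without categories: \<open>f\<close> and
  \<open>g\<close> will underlie \<open>amap F1 \<phi>\<close> and
  \<open>amap F2 (amap \<epsilon> \<phi>)\<close>, and \<open>comm\<close> will come from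
  naturality.\<close>

lemma semigroup_entropy_weak_isomorphism:
  fixes S :: "'s normed_semigroup" and T :: "'t normed_preordered_semigroup"
  assumes S: "normed_semigroup S" and T: "normed_preordered_semigroup T"
    and weak: "weak_isomorphism r S T \<alpha>"
    and f: "f \<in> carrier S \<rightarrow> carrier S"
    and g: "g \<in> carrier T \<rightarrow> carrier T" "monotone_map T T g"
    and comm: "\<And>x. x \<in> carrier S \<Longrightarrow> \<alpha> (f x) = g (\<alpha> x)"
  shows "semigroup_entropy T g = ennreal r * semigroup_entropy S f"
proof -
  have r: "0 < r" and hom: "semigroup_hom S (forget_preorder T) \<alpha>"
    and nrm: "\<And>x. x \<in> carrier S \<Longrightarrow> nrm T (\<alpha> x) = r * nrm S x"
    and cof: "cofinal_subset T (\<alpha> ` carrier S)"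
    using weak by (auto simp: weak_isomorphism_def uniform_isomorphism_def forget_preorder_def)
  have mul: "mul S x y \<in> carrier S" if "x \<in> carrier S" "y \<in> carrier S" for x y
    using S that by (simp add: normed_semigroup_def)
  have at: "semigroup_entropy_at T g (\<alpha> x) = ennreal r * semigroup_entropy_at S f x"
    if x: "x \<in> carrier S" for x
  proof -
    have "nrm T (trajectory T g (\<alpha> x) n) = r * nrm S (trajectory S f x n)" for n
      using trajectory_hom[OF mul f hom comm x, of n] nrm[OF trajectory_closed[OF mul f x], of n]
      by (simp add: trajectory_forget_preorder)
    \<comment> \<open>This includes \<open>n = 0\<close>, where division by 0 makes both sides
      0.\<close>
    then have "ennreal (nrm T (trajectory T g (\<alpha> x) n) / real n)
        = ennreal r * ennreal (nrm S (trajectory S f x n) / real n)" for n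
      using r ennreal_mult'[of r "nrm S (trajectory S f x n) / real n"] by simp
    then show ?thesis
      by (simp add: semigroup_entropy_at_def limsup_cmult_ennreal)
  qed
  have "semigroup_entropy T g = (SUP y \<in> \<alpha> ` carrier S. semigroup_entropy_at T g y)"
    unfolding semigroup_entropy_def
  proof (rule antisym)
    \<comment> \<open>Each \<open>y\<close> lies below some point of the image of
      \<open>\<alpha>\<close>, whose entropy is at least that of \<open>y\<close>.\<close>
    show "(SUP y \<in> carrier T. semigroup_entropy_at T g y)
        \<le> (SUP y \<in> \<alpha> ` carrier S. semigroup_entropy_at T g y)"
      using cof semigroup_entropy_at_mono[OF T g]
      by (intro SUP_mono) (fastforce simp: cofinal_subset_def)
    show "(SUP y \<in> \<alpha> ` carrier S. semigroup_entropy_at T g y)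
        \<le> (SUP y \<in> carrier T. semigroup_entropy_at T g y)"
      using cof by (intro SUP_subset_mono) (auto simp: cofinal_subset_def)
  qed
  also have "\<dots> = (SUP x \<in> carrier S. ennreal r * semigroup_entropy_at S f x)"
    unfolding image_image using at by (intro SUP_cong) simp_all
  \<comment> \<open>For an empty carrier both suprema are 0 in \<open>ennreal\<close>, so the
    equality persists.\<close>
  also have "\<dots> = ennreal r * semigroup_entropy S f"
    by (simp add: semigroup_entropy_def SUP_mult_left_ennreal)
  finally show ?thesis .
qed

text \<open>The domain of a weak isomorphism carries no preorder, while
  \<open>functorial_entropy F1\<close> is taken in the preordered semigroup; this reconciles the
  two.\<close>

lemma semigroup_entropy_forget_preorder:
  "semigroup_entropy (forget_preorder S) f = semigroup_entropy S f"
  unfolding semigroup_entropy_def semigroup_entropy_at_def trajectory_forget_preorder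
  by (simp add: forget_preorder_def)

lemma functor_obj:
  assumes "is_functor C D F" and "X \<in> Obj C"
  shows "omap F X \<in> Obj D"
  using assms
  by (cases "var F") (auto simp: is_functor_def source_cat_def opposite_def Let_def)

text \<open>Source and target of an endomorphism coincide, so reversing arrows makes no difference
  and both variances give the same statement.\<close>

lemma functor_endo:
  assumes "is_functor C D F" and "\<phi> \<in> hom_set C X X"
  shows "amap F \<phi> \<in> hom_set D (omap F X) (omap F X)"
  using assms
  by (cases "var F")
    (auto simp: is_functor_def source_cat_def opposite_def Let_def hom_set_def)

text \<open>For an endomorphism both vertical sides of the naturality square are
  \<open>\<eta> X\<close>, whatever the variance.\<close>

lemma natural_transformation_endo:
  assumes "natural_transformation C D F G \<eta>" and "\<phi> \<in> hom_set C X X"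
  shows "Comp D (\<eta> X) (amap F \<phi>) = Comp D (amap G \<phi>) (\<eta> X)"
  using assms
  by (cases "var F")
    (auto simp: natural_transformation_def source_cat_def opposite_def Let_def hom_set_def)

lemma NSemi_p_endoE:
  assumes "a \<in> hom_set NSemi_p S S"
  obtains f where "a = Arrow S f S" "f \<in> carrier S \<rightarrow> carrier S" "monotone_map S S f"
  using assms
  by (auto simp: hom_set_def NSemi_p_def concrete_cat_def semigroup_hom_def)

text \<open>Surjectivity makes the image the whole carrier, so restricting to it changes nothing,
  and reflexivity of the preorder makes it cofinal.\<close>

lemma uniform_isomorphism_imp_weak:
  assumes "normed_preordered_semigroup T" and "uniform_isomorphism r S (forget_preorder T) \<alpha>"
  shows "weak_isomorphism r S T \<alpha>"
proof -
  have im: "\<alpha> ` carrier S = carrier T"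
    using assms(2)
    by (auto simp: uniform_isomorphism_def forget_preorder_def bij_betw_def)
  then have "forget_preorder T\<lparr>carrier := \<alpha> ` carrier S\<rparr> = forget_preorder T"
    by (simp add: forget_preorder_def)
  moreover have "refl_on (carrier T) (leq T)"
    using assms(1) by (simp add: normed_preordered_semigroup_def preorder_on_def)
  ultimately show ?thesis
    using assms(2) im
    by (auto simp: weak_isomorphism_def cofinal_subset_def uniform_isomorphism_def
        dest: refl_onD)
qed

lemma SBT_imp_SBT_weak:
  assumes "is_functor X1 X2 \<epsilon>" and "is_functor X2 NSemi_p F2" and "SBT X1 \<epsilon> C F1 F2"
  shows "SBT_weak X1 \<epsilon> C F1 F2"
proof -
  have "normed_preordered_semigroup (omap (F2 \<circ>\<^sub>F \<epsilon>) X)" if "X \<in> Obj X1" for X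
    using functor_obj[OF assms(2) functor_obj[OF assms(1) that]]
    by (simp add: comp_func_def NSemi_p_def concrete_cat_def)
  then show ?thesis
    using assms(3) uniform_isomorphism_imp_weak unfolding SBT_def SBT_weak_def by blast
qed

lemma SBT_weak_imp_BT:
  assumes \<epsilon>: "is_functor X1 X2 \<epsilon>" and F1: "is_functor X1 NSemi_p F1"
    and F2: "is_functor X2 NSemi_p F2" and "SBT_weak X1 \<epsilon> C F1 F2"
  shows "BT X1 \<epsilon> C F1 F2"
  unfolding BT_def
proof (intro ballI)
  fix X \<phi> assume X: "X \<in> Obj X1" and \<phi>: "\<phi> \<in> hom_set X1 X X"
  define S where "S = omap F1 X"
  define T where "T = omap F2 (omap \<epsilon> X)"
  obtain \<eta> where nat:
      "natural_transformation X1 NSemi_star (Forget \<circ>\<^sub>F F1) (Forget \<circ>\<^sub>F (F2 \<circ>\<^sub>F \<epsilon>)) \<eta>"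
    and weak: "weak_isomorphism C (forget_preorder S) T (fn (\<eta> X))"
    using assms(4) X by (auto simp: SBT_weak_def S_def T_def comp_func_def)
  have ST: "normed_preordered_semigroup S" "normed_preordered_semigroup T"
    using functor_obj[OF F1 X] functor_obj[OF F2 functor_obj[OF \<epsilon> X]]
    by (simp_all add: NSemi_p_def concrete_cat_def S_def T_def)
  obtain f where f: "amap F1 \<phi> = Arrow S f S" "f \<in> carrier S \<rightarrow> carrier S"
    using functor_endo[OF F1 \<phi>] by (auto simp: S_def elim: NSemi_p_endoE)
  obtain g where g: "amap F2 (amap \<epsilon> \<phi>) = Arrow T g T" "g \<in> carrier T \<rightarrow> carrier T"
      "monotone_map T T g"
    using functor_endo[OF F2 functor_endo[OF \<epsilon> \<phi>]] by (auto simp: T_def elim: NSemi_p_endoE)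
  \<comment> \<open>\<open>Comp\<close> restricts a composite to the carrier of the source of its
    right factor; on one side of the square that factor is \<open>\<eta> X\<close>.\<close>
  have "source (\<eta> X) = forget_preorder S"
    using nat X
    by (simp add: natural_transformation_def hom_set_def NSemi_star_def concrete_cat_def
        comp_func_def Forget_def S_def)
  then have "compose (carrier S) (fn (\<eta> X)) f = compose (carrier S) g (fn (\<eta> X))"
    using natural_transformation_endo[OF nat \<phi>] f(1) g(1)
    by (simp add: NSemi_star_def concrete_cat_def comp_func_def Forget_def forget_preorder_def)
  \<comment> \<open>The composites are extensional maps; evaluating them on the carrier removes the
    restriction.\<close>
  then have comm: "fn (\<eta> X) (f x) = g (fn (\<eta> X) x)" if "x \<in> carrier S" for x
    using that by (metis compose_eq)
  have "semigroup_entropy T g = ennreal C * semigroup_entropy (forget_preorder S) f"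
    using ST f g comm
    by (intro semigroup_entropy_weak_isomorphism[OF _ _ weak])
      (auto simp: normed_preordered_semigroup_def normed_semigroup_def forget_preorder_def)
  then show "functorial_entropy F2 (amap \<epsilon> \<phi>) = ennreal C * functorial_entropy F1 \<phi>"
    by (simp add: functorial_entropy_def f(1) g(1) semigroup_entropy_forget_preorder)
qed

theorem theorem6p9:
  fixes X1 :: "('o1, 'm1) cat" and X2 :: "('o2, 'm2) cat"
    and \<epsilon> :: "('o1, 'm1, 'o2, 'm2) func"
    and F1 :: "('o1, 'm1, 's) nps_functor" and F2 :: "('o2, 'm2, 's) nps_functor"
    and C :: real
  assumes "category X1" and "category X2"
    and "is_functor X1 X2 \<epsilon>"
    and "is_functor X1 NSemi_p F1"
    and "is_functor X2 NSemi_p F2"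
    and "var F1 = var (F2 \<circ>\<^sub>F \<epsilon>)"
    and "0 < C"
  shows "(SBT X1 \<epsilon> C F1 F2 \<longrightarrow> SBT_weak X1 \<epsilon> C F1 F2)
    \<and> (SBT_weak X1 \<epsilon> C F1 F2 \<longrightarrow> BT X1 \<epsilon> C F1 F2)
    \<and> (SBT X1 \<epsilon> 1 F1 F2 \<longrightarrow> SBT_weak X1 \<epsilon> 1 F1 F2)
    \<and> (SBT_weak X1 \<epsilon> 1 F1 F2 \<longrightarrow> BT X1 \<epsilon> 1 F1 F2)"
  \<comment> \<open>The two lemmas leave the coefficient arbitrary, so the last two conjuncts are
    their instances at 1.\<close>
  using assms SBT_imp_SBT_weak SBT_weak_imp_BT by blast

end
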